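(* For every partial Boolean function $f$, $\widetilde{\mathrm{R}}^{\mathrm{na}}(f)=\Theta(\mathrm{R}^{\mathrm{na}}(f))$, with universal constants in the $\Theta$.
   Context: A partial Boolean function on $n$ bits is a map $f\colon\mathrm{Dom}(f)\to\{0,1\}$, $\mathrm{Dom}(f)\subseteq\{0,1\}^n$. A deterministic non-adaptive algorithm is a pair $(S,\alpha)$ with $S\subseteq[n]$ and $\alpha\colon\{0,1\}^S\to\{0,1\}$; on input $x$ it outputs $\alpha(x_S)$ ($x$ restricted to $S$). A randomized non-adaptive algorithm is a probability distribution over such pairs; its height is the maximum $|S|$ over its support; it computes $f$ to error $\epsilon$ if for every $x\in\mathrm{Dom}(f)$ it outputs $f(x)$ with probability at least $1-\epsilon$. $\mathrm{R}^{\mathrm{na}}(f)$ is the minimum height of a randomized non-adaptive algorithm computing $f$ to error $1/3$. A noisy oracle for a bit $b$ accepts $\gamma\in(0,1]$ and returns a fresh independent bit equal to $b$ with probability $(1+\gamma)/2$, at cost $\gamma^2$. A noisy non-adaptive algorithm is a finite-support probability distribution over pairs $(S,\alpha)$ where $S$ is a finite multiset of pairs $(i,\gamma)$, $i\in[n]$, $\gamma\in(0,1]$, and $\alpha$ is a Boolean function of the answers; on input $x$ it samples $(S,\alpha)$, for each $(i,\gamma)\in S$ calls the noisy oracle for $x_i$ with parameter $\gamma$, and outputs $\alpha$ applied to the answers. The cost of $S$ is $\sum_{(i,\gamma)\in S}\gamma^2$, and the cost of the algorithm is the expected cost of $S$. It computes $f$ to error $\epsilon$ if it outputs $f(x)$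 with probability $\ge 1-\epsilon$ for every $x\in\mathrm{Dom}(f)$. $\widetilde{\mathrm{R}}^{\mathrm{na}}(f)$ is the infimum of the cost of noisy non-adaptive algorithms computing $f$ to error $1/3$. *)

theory Defs
  imports "HOL-Probability.Product_PMF" "HOL-Library.FuncSet" "HOL-Library.Multiset"
begin

text \<open>Bits are indexed from \<open>0\<close>, so \<open>[n]\<close> is \<open>{..<n}\<close>; an input in \<open>{0,1}\<^sup>n\<close> is a list of length \<open>n\<close>.\<close>

definition partial_boolean_function :: "nat \<Rightarrow> (bool list \<rightharpoonup> bool) \<Rightarrow> bool" where
  "partial_boolean_function n f \<longleftrightarrow> dom f \<subseteq> {x. length x = n}"

text \<open>\<open>out x\<close> is the distribution of the output of an algorithm on input \<open>x\<close>.\<close>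

definition computes_to_error ::
    "(bool list \<Rightarrow> bool pmf) \<Rightarrow> (bool list \<rightharpoonup> bool) \<Rightarrow> real \<Rightarrow> bool" where
  "computes_to_error out f \<epsilon> \<longleftrightarrow> (\<forall>x\<in>dom f. pmf (out x) (the (f x)) \<ge> 1 - \<epsilon>)"

text \<open>The function \<open>\<alpha>\<close> of a pair \<open>(S, \<alpha>)\<close> is only ever applied to elements of
  \<open>S \<rightarrow>\<^sub>E UNIV\<close>, which represents \<open>{0,1}\<^sup>S\<close>; its values elsewhere are irrelevant.\<close>

type_synonym na_alg = "nat set \<times> ((nat \<Rightarrow> bool) \<Rightarrow> bool)"

definition na_output :: "na_alg \<Rightarrow> bool list \<Rightarrow> bool" where
  "na_output = (\<lambda>(S, \<alpha>) x. \<alpha> (restrict (\<lambda>i. x ! i) S))"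

definition is_randomized_na_alg :: "nat \<Rightarrow> na_alg pmf \<Rightarrow> bool" where
  "is_randomized_na_alg n A \<longleftrightarrow> (\<forall>(S, \<alpha>)\<in>set_pmf A. S \<subseteq> {..<n})"

definition randomized_na_output :: "na_alg pmf \<Rightarrow> bool list \<Rightarrow> bool pmf" where
  "randomized_na_output A x = map_pmf (\<lambda>D. na_output D x) A"

definition na_height :: "na_alg pmf \<Rightarrow> nat" where
  "na_height A = Max ((\<lambda>(S, \<alpha>). card S) ` set_pmf A)"

definition R_na :: "nat \<Rightarrow> (bool list \<rightharpoonup> bool) \<Rightarrow> nat" where
  "R_na n f = (LEAST h. \<exists>A. is_randomized_na_alg n A \<and>
     computes_to_error (randomized_na_output A) f (1/3) \<and> na_height A = h)"

definition noisy_oracle :: "bool \<Rightarrow> real \<Rightarrow> bool pmf" where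
  "noisy_oracle b \<gamma> = map_pmf (\<lambda>correct. if correct then b else \<not> b) (bernoulli_pmf ((1 + \<gamma>) / 2))"

type_synonym noisy_query = "nat \<times> real"

text \<open>The individual oracle calls of a multiset of queries: equal queries \<open>q\<close> are told apart by
  a second component \<open>k < count S q\<close>, so that each occurrence gets its own answer.\<close>

definition calls :: "noisy_query multiset \<Rightarrow> (noisy_query \<times> nat) set" where
  "calls S = (SIGMA q : set_mset S. {..<count S q})"

type_synonym noisy_na_alg = "noisy_query multiset \<times> ((noisy_query \<times> nat \<Rightarrow> bool) \<Rightarrow> bool)"

definition noisy_answers :: "noisy_query multiset \<Rightarrow> bool list \<Rightarrow> (noisy_query \<times> nat \<Rightarrow> bool) pmf" where
  "noisy_answers S x = Pi_pmf (calls S) undefined (\<lambda>((i, \<gamma>), k). noisy_oracle (x ! i) \<gamma>)"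

definition is_noisy_na_alg :: "nat \<Rightarrow> noisy_na_alg pmf \<Rightarrow> bool" where
  "is_noisy_na_alg n A \<longleftrightarrow> finite (set_pmf A) \<and>
     (\<forall>(S, \<alpha>)\<in>set_pmf A. \<forall>(i, \<gamma>)\<in>#S. i < n \<and> 0 < \<gamma> \<and> \<gamma> \<le> 1)"

definition noisy_na_output :: "noisy_na_alg pmf \<Rightarrow> bool list \<Rightarrow> bool pmf" where
  "noisy_na_output A x = bind_pmf A (\<lambda>(S, \<alpha>). map_pmf \<alpha> (noisy_answers S x))"

definition query_cost :: "noisy_query multiset \<Rightarrow> real" where
  "query_cost S = (\<Sum>(i, \<gamma>)\<in>#S. \<gamma>\<^sup>2)"

definition noisy_na_cost :: "noisy_na_alg pmf \<Rightarrow> real" where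
  "noisy_na_cost A = measure_pmf.expectation A (\<lambda>(S, \<alpha>). query_cost S)"

definition noisy_R_na :: "nat \<Rightarrow> (bool list \<rightharpoonup> bool) \<Rightarrow> real" where
  "noisy_R_na n f = Inf {noisy_na_cost A |A. is_noisy_na_alg n A \<and>
     computes_to_error (noisy_na_output A) f (1/3)}"

end

theory Submission imports Defs begin

text \<open>
  Exact queries are noisy queries with \<open>\<gamma> = 1\<close>. Conversely, write bits as signs and let
  \<open>z\<^sub>c\<close> be the bit asked for by the noisy call \<open>c\<close>. Reveal each \<open>z\<^sub>c\<close> independently with
  probability \<open>\<gamma>\<^sub>c\<^sup>2\<close>, so that the expected number of revealed bits is the cost, and let \<open>T\<close> be the
  set of revealed calls. For uniformly random answers \<open>y\<close>, the number
  \<open>h\<^sub>T = E\<^sub>y [\<alpha>(y) \<Prod>\<^bsub>c\<in>T\<^esub> (1 + y\<^sub>c z\<^sub>c / \<gamma>\<^sub>c)]\<close> depends only on revealed bits and satisfies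
  \<open>E\<^sub>T [h\<^sub>T] = E\<^sub>T [h\<^sub>T\<^sup>2] = Pr[\<alpha>(noisy answers) = 1]\<close>: in the second moment all terms with two
  different answer vectors cancel. Since the variance is at most \<open>1/4\<close>, averaging 54 independent
  copies and comparing with \<open>1/2\<close> errs with probability at most \<open>1/6\<close> (Chebyshev), and giving up
  when more than 6 times the expected number of bits is revealed costs another \<open>1/6\<close> (Markov).
\<close>

subsection \<open>Finitely supported product distributions\<close>

lemma finite_set_Pi_pmf:
  assumes "finite A" "\<And>x. x \<in> A \<Longrightarrow> finite (set_pmf (p x))"
  shows "finite (set_pmf (Pi_pmf A d p))"
  using assms by (auto simp: set_Pi_pmf)

text \<open>Fubini for finite supports, where every real function is integrable. All distributions
  to be averaged over below are finitely supported.\<close>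

lemma expectation_pair_pmf_finite:
  fixes F :: "_ \<Rightarrow> real"
  assumes "finite (set_pmf p)" "finite (set_pmf q)"
  shows "measure_pmf.expectation (pair_pmf p q) F =
    measure_pmf.expectation p (\<lambda>a. measure_pmf.expectation q (\<lambda>b. F (a, b)))"
proof -
  have "measure_pmf.expectation (pair_pmf p q) F =
      (\<Sum>a\<in>set_pmf p. pmf p a *\<^sub>R measure_pmf.expectation (map_pmf (Pair a) q) F)"
    unfolding pair_pmf_def map_pmf_def[symmetric]
    by (subst pmf_expectation_bind[of "set_pmf p"]) (use assms in \<open>auto simp: map_pmf_def[symmetric]\<close>)
  also have "\<dots> = measure_pmf.expectation p (\<lambda>a. measure_pmf.expectation q (\<lambda>b. F (a, b)))"
    using assms by (subst integral_measure_pmf[of "set_pmf p"]) auto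
  finally show ?thesis .
qed

lemma expectation_Pi_pmf_insert:
  fixes F :: "_ \<Rightarrow> real"
  assumes "finite A" "x \<notin> A" "\<And>y. y \<in> insert x A \<Longrightarrow> finite (set_pmf (p y))"
  shows "measure_pmf.expectation (Pi_pmf (insert x A) d p) F =
    measure_pmf.expectation (p x) (\<lambda>a. measure_pmf.expectation (Pi_pmf A d p) (\<lambda>f. F (f(x := a))))"
  using assms
  by (simp add: Pi_pmf_insert expectation_pair_pmf_finite finite_set_Pi_pmf)

lemma expectation_prod_Pi_pmf_finite:
  fixes g :: "_ \<Rightarrow> _ \<Rightarrow> real"
  assumes "finite A" "\<And>x. x \<in> A \<Longrightarrow> finite (set_pmf (p x))"
  shows "measure_pmf.expectation (Pi_pmf A d p) (\<lambda>f. \<Prod>x\<in>A. g x (f x)) =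
    (\<Prod>x\<in>A. measure_pmf.expectation (p x) (g x))"
  using assms
proof (induction A rule: finite_induct)
  case (insert x A)
  have "(\<Prod>y\<in>A. g y (if y = x then a else f y)) = (\<Prod>y\<in>A. g y (f y))" for a f
    using insert.hyps by (intro prod.cong) auto
  then show ?case
    using insert by (subst expectation_Pi_pmf_insert) auto
qed simp

lemma expectation_sum_Pi_pmf:
  fixes W :: "_ \<Rightarrow> _ \<Rightarrow> real"
  assumes "finite A" "\<And>x. x \<in> A \<Longrightarrow> finite (set_pmf (p x))"
  shows "measure_pmf.expectation (Pi_pmf A d p) (\<lambda>f. \<Sum>x\<in>A. W x (f x)) =
    (\<Sum>x\<in>A. measure_pmf.expectation (p x) (W x))"
proof -
  have "measure_pmf.expectation (Pi_pmf A d p) (\<lambda>f. W x (f x)) = measure_pmf.expectation (p x) (W x)"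
    if "x \<in> A" for x
  proof -
    have "measure_pmf.expectation (Pi_pmf A d p) (\<lambda>f. W x (f x)) =
        measure_pmf.expectation (map_pmf (\<lambda>f. f x) (Pi_pmf A d p)) (W x)"
      by simp
    then show ?thesis
      using that assms(1) by (simp only: Pi_pmf_component if_True)
  qed
  then show ?thesis
    by (subst Bochner_Integration.integral_sum)
       (auto intro!: integrable_measure_pmf_finite finite_set_Pi_pmf assms)
qed

text \<open>Independence and centring kill the cross terms. Applied to centred copies of one
  estimate, this gives the variance for Chebyshev's inequality.\<close>

lemma expectation_sum_square_Pi_pmf:
  fixes W :: "_ \<Rightarrow> _ \<Rightarrow> real"
  assumes "finite A" "\<And>x. x \<in> A \<Longrightarrow> finite (set_pmf (p x))"
    and "\<And>x. x \<in> A \<Longrightarrow> measure_pmf.expectation (p x) (W x) = 0"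
  shows "measure_pmf.expectation (Pi_pmf A d p) (\<lambda>f. (\<Sum>x\<in>A. W x (f x))\<^sup>2) =
    (\<Sum>x\<in>A. measure_pmf.expectation (p x) (\<lambda>a. (W x a)\<^sup>2))"
  using assms
proof (induction A rule: finite_induct)
  case (insert x A)
  define q where "q = Pi_pmf A d p"
  define s where "s = (\<lambda>f. \<Sum>y\<in>A. W y (f y))"
  have fin: "finite (set_pmf q)" "finite (set_pmf (p x))"
    using insert by (auto simp: q_def intro!: finite_set_Pi_pmf)
  note int = integrable_measure_pmf_finite[OF fin(1)] integrable_measure_pmf_finite[OF fin(2)]
  have s_upd: "(\<Sum>y\<in>insert x A. W y ((f(x := a)) y)) = W x a + s f" for f a
  proof -
    have "(\<Sum>y\<in>A. W y ((f(x := a)) y)) = s f"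
      unfolding s_def using insert.hyps by (intro sum.cong) auto
    then show ?thesis
      using insert.hyps by simp
  qed
  have s0: "measure_pmf.expectation q s = 0"
    unfolding q_def s_def using insert by (subst expectation_sum_Pi_pmf) auto
  have "measure_pmf.expectation (Pi_pmf (insert x A) d p) (\<lambda>f. (\<Sum>y\<in>insert x A. W y (f y))\<^sup>2) =
      measure_pmf.expectation (p x) (\<lambda>a. measure_pmf.expectation q (\<lambda>f. (W x a + s f)\<^sup>2))"
    using insert by (subst expectation_Pi_pmf_insert) (auto simp only: s_upd q_def)
  also have "\<dots> = measure_pmf.expectation (p x)
      (\<lambda>a. (W x a)\<^sup>2 + measure_pmf.expectation q (\<lambda>f. (s f)\<^sup>2))"
    using s0 by (simp add: power2_sum int)
  also have "\<dots> = measure_pmf.expectation (p x) (\<lambda>a. (W x a)\<^sup>2) +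
      measure_pmf.expectation q (\<lambda>f. (s f)\<^sup>2)"
    by (simp add: int)
  also have "measure_pmf.expectation q (\<lambda>f. (s f)\<^sup>2) =
      (\<Sum>x\<in>A. measure_pmf.expectation (p x) (\<lambda>a. (W x a)\<^sup>2))"
    unfolding q_def s_def using insert by auto
  finally show ?case
    using insert.hyps by simp
qed simp

subsection \<open>Replacing noise by random erasures\<close>

definition sgn_agree :: "bool \<Rightarrow> bool \<Rightarrow> real" where
  "sgn_agree a b = (if a = b then 1 else - 1)"

text \<open>A signed weight on the answer \<open>y\<close> with total mass 1: uniform if the call is
  erased, and otherwise biased towards \<open>z\<close> by \<open>1 / \<gamma>\<close>, which makes
  it negative at \<open>y \<noteq> z\<close> when \<open>\<gamma> < 1\<close>. The factor 1/2 is the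
  uniform probability of a single answer.\<close>

definition erasure_weight :: "real \<Rightarrow> bool \<Rightarrow> bool \<Rightarrow> bool \<Rightarrow> real" where
  "erasure_weight \<gamma> z y revealed = (if revealed then (1 + sgn_agree y z / \<gamma>) / 2 else 1 / 2)"

definition erasure_pmf :: "'c set \<Rightarrow> ('c \<Rightarrow> real) \<Rightarrow> ('c \<Rightarrow> bool) pmf" where
  "erasure_pmf C \<gamma> = Pi_pmf C False (\<lambda>c. bernoulli_pmf ((\<gamma> c)\<^sup>2))"

text \<open>This is \<open>h\<^sub>T\<close> of the overview: the product of the factors 1/2 turns
  the sum over \<open>y\<close> into a uniform average. Answer vectors take the value
  \<open>undefined\<close> outside \<open>C\<close>, as in \<open>noisy_answers\<close>, so there
  are finitely many.\<close>

definition erasure_estimator ::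
    "'c set \<Rightarrow> ('c \<Rightarrow> real) \<Rightarrow> (('c \<Rightarrow> bool) \<Rightarrow> bool) \<Rightarrow> ('c \<Rightarrow> bool) \<Rightarrow> ('c \<Rightarrow> bool) \<Rightarrow> real" where
  "erasure_estimator C \<gamma> \<alpha> z T =
     (\<Sum>y\<in>PiE_dflt C undefined (\<lambda>_. UNIV). of_bool (\<alpha> y) * (\<Prod>c\<in>C. erasure_weight (\<gamma> c) (z c) (y c) (T c)))"

lemma pmf_noisy_oracle:
  assumes "0 < \<gamma>" "\<gamma> \<le> 1"
  shows "pmf (noisy_oracle z \<gamma>) y = (1 + \<gamma> * sgn_agree y z) / 2"
proof -
  have inj: "inj (\<lambda>correct. if correct then z else \<not> z)"
    by (auto simp: inj_def)
  have "pmf (noisy_oracle z \<gamma>) ((\<lambda>correct. if correct then z else \<not> z) (y = z)) =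
      pmf (bernoulli_pmf ((1 + \<gamma>) / 2)) (y = z)"
    unfolding noisy_oracle_def by (rule pmf_map_inj'[OF inj])
  moreover have "(if y = z then z else \<not> z) = y"
    by auto
  ultimately show ?thesis
    using assms by (cases "y = z") (auto simp: sgn_agree_def field_simps)
qed

text \<open>The bias \<open>1 / \<gamma>\<close> occurs with probability
  \<open>\<gamma>\<^sup>2\<close>, so the average bias is \<open>\<gamma>\<close>, that of the noisy
  oracle.\<close>

lemma expectation_erasure_weight:
  assumes "0 < \<gamma>" "\<gamma> \<le> 1"
  shows "measure_pmf.expectation (bernoulli_pmf (\<gamma>\<^sup>2)) (erasure_weight \<gamma> z y) =
    pmf (noisy_oracle z \<gamma>) y"
  using assms
  by (subst integral_bernoulli_pmf)
     (auto simp: pmf_noisy_oracle erasure_weight_def mult_le_one field_simps power2_eq_square)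

text \<open>The revealing probability \<open>\<gamma>\<^sup>2\<close> is exactly the one for which distinct answers are uncorrelated.\<close>

lemma expectation_erasure_weight_mult:
  assumes "0 < \<gamma>" "\<gamma> \<le> 1"
  shows "measure_pmf.expectation (bernoulli_pmf (\<gamma>\<^sup>2)) (\<lambda>t. erasure_weight \<gamma> z y t * erasure_weight \<gamma> z y' t) =
    (if y = y' then pmf (noisy_oracle z \<gamma>) y else 0)"
  using assms
  by (subst integral_bernoulli_pmf; cases y; cases y'; cases z)
     (auto simp: pmf_noisy_oracle erasure_weight_def sgn_agree_def mult_le_one field_simps power2_eq_square)

lemma finite_set_erasure_pmf: "finite C \<Longrightarrow> finite (set_pmf (erasure_pmf C \<gamma>))"
  unfolding erasure_pmf_def by (intro finite_set_Pi_pmf) (auto intro: finite_subset[OF subset_UNIV])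

text \<open>Weights of erased calls do not depend on \<open>z\<close>. Hence an algorithm that reads
  only the revealed bits can evaluate the estimator.\<close>

lemma erasure_estimator_cong:
  assumes "\<And>c. c \<in> C \<Longrightarrow> T c \<Longrightarrow> z' c = z c"
  shows "erasure_estimator C \<gamma> \<alpha> z' T = erasure_estimator C \<gamma> \<alpha> z T"
  unfolding erasure_estimator_def
  by (intro sum.cong prod.cong refl arg_cong2[of _ _ _ _ "(*)"]) (auto simp: erasure_weight_def assms)

context
  fixes C :: "'c set" and \<gamma> :: "'c \<Rightarrow> real" and z :: "'c \<Rightarrow> bool"
  assumes fin: "finite C" and \<gamma>: "\<And>c. c \<in> C \<Longrightarrow> 0 < \<gamma> c \<and> \<gamma> c \<le> 1"
begin

private abbreviation "noise \<equiv> Pi_pmf C undefined (\<lambda>c. noisy_oracle (z c) (\<gamma> c))"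
private abbreviation "Y \<equiv> PiE_dflt C undefined (\<lambda>_. UNIV) :: ('c \<Rightarrow> bool) set"

private lemma finite_Y: "finite Y"
  using fin by auto

private lemma integrable_erasure: "integrable (measure_pmf (erasure_pmf C \<gamma>)) (F :: _ \<Rightarrow> real)"
  by (rule integrable_measure_pmf_finite[OF finite_set_erasure_pmf[OF fin]])

private lemma pmf_noise: "y \<in> Y \<Longrightarrow> pmf noise y = (\<Prod>c\<in>C. pmf (noisy_oracle (z c) (\<gamma> c)) (y c))"
  by (subst pmf_Pi'[OF fin]) (auto simp: PiE_dflt_def)

private lemma prob_noise:
  "pmf (map_pmf \<alpha> noise) True = (\<Sum>y\<in>Y. of_bool (\<alpha> y) * pmf noise y)"
proof -
  have sub: "set_pmf noise \<subseteq> Y"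
    using set_Pi_pmf_subset[OF fin, of undefined "\<lambda>c. noisy_oracle (z c) (\<gamma> c)"]
    by (auto simp: PiE_dflt_def)
  have "pmf (map_pmf \<alpha> noise) True = measure_pmf.expectation noise (\<lambda>y. of_bool (\<alpha> y))"
    using integral_measure_pmf_real[of UNIV "map_pmf \<alpha> noise" of_bool] by (simp add: UNIV_bool)
  also have "\<dots> = (\<Sum>y\<in>Y. of_bool (\<alpha> y) * pmf noise y)"
    using sub by (intro integral_measure_pmf_real finite_Y) auto
  finally show ?thesis .
qed

text \<open>Linearity over answer vectors and independence across calls reduce unbiasedness to the
  identity for a single call.\<close>

lemma expectation_erasure_estimator:
  "measure_pmf.expectation (erasure_pmf C \<gamma>) (erasure_estimator C \<gamma> \<alpha> z) =
   pmf (map_pmf \<alpha> (Pi_pmf C undefined (\<lambda>c. noisy_oracle (z c) (\<gamma> c)))) True"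
proof -
  have "measure_pmf.expectation (erasure_pmf C \<gamma>) (\<lambda>T. \<Prod>c\<in>C. erasure_weight (\<gamma> c) (z c) (y c) (T c)) =
      pmf noise y" if "y \<in> Y" for y
    unfolding erasure_pmf_def pmf_noise[OF that]
    by (subst expectation_prod_Pi_pmf_finite[OF fin])
       (auto intro: finite_subset[OF subset_UNIV] intro!: prod.cong expectation_erasure_weight simp: \<gamma>)
  then show ?thesis
    unfolding erasure_estimator_def prob_noise
    by (subst Bochner_Integration.integral_sum) (auto simp: integrable_erasure)
qed

text \<open>Expanding the square gives a sum over pairs of answer vectors. Weights of distinct
  vectors are orthogonal, so only the diagonal survives, and there it reproduces the first
  moment.\<close>

lemma expectation_erasure_estimator_square:
  "measure_pmf.expectation (erasure_pmf C \<gamma>) (\<lambda>T. (erasure_estimator C \<gamma> \<alpha> z T)\<^sup>2) =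
   pmf (map_pmf \<alpha> (Pi_pmf C undefined (\<lambda>c. noisy_oracle (z c) (\<gamma> c)))) True"
proof -
  define w where "w y T = (\<Prod>c\<in>C. erasure_weight (\<gamma> c) (z c) (y c) (T c))" for y T
  have orth: "measure_pmf.expectation (erasure_pmf C \<gamma>) (\<lambda>T. w y T * w y' T) =
      (if y = y' then pmf noise y else 0)" if "y \<in> Y" "y' \<in> Y" for y y'
  proof -
    have "measure_pmf.expectation (erasure_pmf C \<gamma>) (\<lambda>T. w y T * w y' T) =
        (\<Prod>c\<in>C. if y c = y' c then pmf (noisy_oracle (z c) (\<gamma> c)) (y c) else 0)"
      unfolding erasure_pmf_def w_def prod.distrib[symmetric]
      by (subst expectation_prod_Pi_pmf_finite[OF fin, where g =
            "\<lambda>c t. erasure_weight (\<gamma> c) (z c) (y c) t * erasure_weight (\<gamma> c) (z c) (y' c) t"])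
         (auto intro: finite_subset[OF subset_UNIV] intro!: prod.cong simp: \<gamma> expectation_erasure_weight_mult)
    also have "\<dots> = (if y = y' then pmf noise y else 0)"
    proof (cases "y = y'")
      \<comment> \<open>Both vectors are \<open>undefined\<close> outside \<open>C\<close>, so they
        differ at some call in \<open>C\<close>. Its factor is \<open>\<gamma>\<^sup>2 * (1 - 1 /
        \<gamma>\<^sup>2) / 4 + (1 - \<gamma>\<^sup>2) / 4 = 0\<close>.\<close>
      case False
      then obtain c where "y c \<noteq> y' c" by auto
      moreover from this have "c \<in> C" using that by (auto simp: PiE_dflt_def)
      ultimately show ?thesis using False fin by (auto intro!: prod_zero)
    qed (use pmf_noise[OF that(1)] in simp)
    finally show ?thesis .
  qed
  have "measure_pmf.expectation (erasure_pmf C \<gamma>) (\<lambda>T. (erasure_estimator C \<gamma> \<alpha> z T)\<^sup>2) =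
      measure_pmf.expectation (erasure_pmf C \<gamma>)
        (\<lambda>T. \<Sum>y\<in>Y. \<Sum>y'\<in>Y. of_bool (\<alpha> y) * of_bool (\<alpha> y') * (w y T * w y' T))"
    unfolding erasure_estimator_def power2_eq_square sum_product w_def by (simp only: mult_ac)
  also have "\<dots> = (\<Sum>y\<in>Y. \<Sum>y'\<in>Y. of_bool (\<alpha> y) * of_bool (\<alpha> y') *
      measure_pmf.expectation (erasure_pmf C \<gamma>) (\<lambda>T. w y T * w y' T))"
    by (simp add: Bochner_Integration.integral_sum integrable_erasure)
  also have "\<dots> = (\<Sum>y\<in>Y. \<Sum>y'\<in>Y. if y' = y then of_bool (\<alpha> y) * pmf noise y else 0)"
    by (intro sum.cong refl) (auto simp: orth)
  also have "\<dots> = pmf (map_pmf \<alpha> noise) True"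
    unfolding prob_noise by (simp add: finite_Y)
  finally show ?thesis .
qed

lemma expectation_card_erasure:
  "measure_pmf.expectation (erasure_pmf C \<gamma>) (\<lambda>T. real (card {c\<in>C. T c})) = (\<Sum>c\<in>C. (\<gamma> c)\<^sup>2)"
proof -
  have "real (card {c\<in>C. T c}) = (\<Sum>c\<in>C. of_bool (T c))" for T
    using fin by (simp add: sum.If_cases Int_def flip: of_bool_def)
  then show ?thesis
    unfolding erasure_pmf_def
    using \<gamma> by (simp, subst expectation_sum_Pi_pmf[OF fin])
       (auto intro: finite_subset[OF subset_UNIV] intro!: sum.cong simp: power_le_one less_imp_le)
qed

end

subsection \<open>From noisy to exact queries\<close>

text \<open>Chebyshev: equal first and second moments give each copy the variance
  \<open>g - g\<^sup>2\<close>, at most 1/4, so the sum has variance at most 54/4 = 27/2, and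
  (27/2)/81 = 1/6. The deviation 9 is 54 * (2/3 - 1/2), the distance from 54 times a success
  probability of 2/3 to the threshold 27.\<close>

lemma prob_sum_iid_deviation:
  fixes Z :: "'b \<Rightarrow> real"
  assumes fin: "finite (set_pmf B)"
    and mean: "measure_pmf.expectation B Z = g"
    and square: "measure_pmf.expectation B (\<lambda>b. (Z b)\<^sup>2) = g"
  shows "measure_pmf.prob (Pi_pmf {..<54::nat} d (\<lambda>_. B)) {\<omega>. \<bar>(\<Sum>j<54. Z (\<omega> j)) - 54 * g\<bar> \<ge> 9} \<le> 1 / 6"
proof -
  define P where "P = Pi_pmf {..<54::nat} d (\<lambda>_. B)"
  define V where "V = (\<lambda>\<omega>. \<Sum>j<54::nat. Z (\<omega> j) - g)"
  note int = integrable_measure_pmf_finite[OF fin]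
  have finP: "finite (set_pmf P)"
    unfolding P_def by (intro finite_set_Pi_pmf fin) auto
  have "measure_pmf.expectation P (\<lambda>\<omega>. (V \<omega>)\<^sup>2) =
      (\<Sum>j<54::nat. measure_pmf.expectation B (\<lambda>b. (Z b - g)\<^sup>2))"
    unfolding P_def V_def
    by (rule expectation_sum_square_Pi_pmf) (auto simp: fin int mean)
  also have "\<dots> = 54 * (g - g\<^sup>2)"
    by (simp add: power2_diff int mean square) (simp add: power2_eq_square)
  also have "g - g\<^sup>2 \<le> 1 / 4"
    using zero_le_power2[of "g - 1 / 2"] by (simp add: power2_diff power2_eq_square field_simps)
  finally have var: "measure_pmf.expectation P (\<lambda>\<omega>. (V \<omega>)\<^sup>2) \<le> 27 / 2"
    by simp
  have "{\<omega>. \<bar>(\<Sum>j<54. Z (\<omega> j)) - 54 * g\<bar> \<ge> 9} \<subseteq> {\<omega>. (V \<omega>)\<^sup>2 \<ge> 81}"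
  proof safe
    fix \<omega> :: "nat \<Rightarrow> 'b" assume "9 \<le> \<bar>(\<Sum>j<54. Z (\<omega> j)) - 54 * g\<bar>"
    then have "9 \<le> \<bar>V \<omega>\<bar>" by (simp add: V_def sum_subtractf)
    then have "9\<^sup>2 \<le> \<bar>V \<omega>\<bar>\<^sup>2" by (intro power_mono) auto
    then show "81 \<le> (V \<omega>)\<^sup>2" by simp
  qed
  then have "measure_pmf.prob P {\<omega>. \<bar>(\<Sum>j<54. Z (\<omega> j)) - 54 * g\<bar> \<ge> 9} \<le>
      measure_pmf.prob P {\<omega>\<in>space P. (V \<omega>)\<^sup>2 \<ge> 81}"
    by (intro measure_pmf.finite_measure_mono) auto
  also have "\<dots> \<le> measure_pmf.expectation P (\<lambda>\<omega>. (V \<omega>)\<^sup>2) / 81"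
    by (rule integral_Markov_inequality_measure[where A = "{}"])
       (auto intro: integrable_measure_pmf_finite[OF finP])
  finally show ?thesis
    using var unfolding P_def by simp
qed

section \<open>Random erasures for a whole noisy algorithm\<close>

lemma finite_calls: "finite (calls S)"
  by (simp add: calls_def)

lemma query_cost_eq_sum_calls: "query_cost S = (\<Sum>c\<in>calls S. (snd (fst c))\<^sup>2)"
proof -
  \<comment> \<open>A fixed finite superset \<open>U\<close> of the support keeps the index set
    constant during the induction on \<open>S\<close>.\<close>
  have "(\<Sum>q\<in>#S. g q) = (\<Sum>q\<in>U. of_nat (count S q) * g q)"
    if "set_mset S \<subseteq> U" "finite U" for g :: "_ \<Rightarrow> real" and U
    using that(1)
  proof (induction S)
    case (add x S)
    have "(\<Sum>q\<in>U. of_nat (count (add_mset x S) q) * g q) =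
        (\<Sum>q\<in>U. (if q = x then g q else 0) + of_nat (count S q) * g q)"
      by (intro sum.cong) (auto simp: algebra_simps)
    then show ?case
      using add that(2) by (simp add: sum.distrib)
  qed simp
  from this[of "set_mset S"] show ?thesis
    by (simp add: query_cost_def calls_def sum.Sigma[symmetric, where g = "\<lambda>q k. (snd q)\<^sup>2", unfolded case_prod_unfold] case_prod_unfold)
qed

type_synonym erased_run =
  "noisy_query multiset \<times> ((noisy_query \<times> nat \<Rightarrow> bool) \<Rightarrow> bool) \<times> (noisy_query \<times> nat \<Rightarrow> bool)"

text \<open>All randomness of one run, drawn before any input bit is read, as non-adaptivity
  demands. For a call, \<open>snd \<circ> fst\<close> is its accuracy and
  \<open>fst \<circ> fst\<close> its bit index.\<close>

definition erased_runs :: "noisy_na_alg pmf \<Rightarrow> erased_run pmf" where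
  "erased_runs A = bind_pmf A (\<lambda>(S, \<alpha>). map_pmf (\<lambda>T. (S, \<alpha>, T)) (erasure_pmf (calls S) (snd \<circ> fst)))"

definition revealed :: "erased_run \<Rightarrow> (noisy_query \<times> nat) set" where
  "revealed = (\<lambda>(S, \<alpha>, T). {c\<in>calls S. T c})"

text \<open>The input is a function \<open>v\<close> on indices, so that the estimate can be
  evaluated both at the full input and at its restriction to the queried bits.\<close>

definition run_estimate :: "(nat \<Rightarrow> bool) \<Rightarrow> erased_run \<Rightarrow> real" where
  "run_estimate v = (\<lambda>(S, \<alpha>, T). erasure_estimator (calls S) (snd \<circ> fst) \<alpha> (v \<circ> fst \<circ> fst) T)"

lemma finite_revealed: "finite (revealed b)"
  by (auto simp: revealed_def finite_calls split: prod.splits)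

lemma run_estimate_cong:
  assumes "\<And>c. c \<in> revealed b \<Longrightarrow> v (fst (fst c)) = v' (fst (fst c))"
  shows "run_estimate v b = run_estimate v' b"
  using assms by (auto simp: run_estimate_def revealed_def split: prod.splits intro!: erasure_estimator_cong)

lemma noisy_answers_eq:
  "noisy_answers S x = Pi_pmf (calls S) undefined (\<lambda>c. noisy_oracle (((!) x \<circ> fst \<circ> fst) c) ((snd \<circ> fst) c))"
  by (simp add: noisy_answers_def case_prod_unfold)

context
  fixes n :: nat and A :: "noisy_na_alg pmf"
  assumes A: "is_noisy_na_alg n A"
begin

lemma finite_set_erased_runs: "finite (set_pmf (erased_runs A))"
  using A by (auto simp: erased_runs_def is_noisy_na_alg_def finite_set_erasure_pmf finite_calls)

lemma revealed_index_less:
  assumes "b \<in> set_pmf (erased_runs A)" "c \<in> revealed b"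
  shows "fst (fst c) < n"
  using assms A by (fastforce simp: erased_runs_def revealed_def calls_def is_noisy_na_alg_def)

lemma expectation_erased_runs:
  fixes F :: "erased_run \<Rightarrow> real"
  shows "measure_pmf.expectation (erased_runs A) F =
    measure_pmf.expectation A (\<lambda>(S, \<alpha>). measure_pmf.expectation (erasure_pmf (calls S) (snd \<circ> fst)) (\<lambda>T. F (S, \<alpha>, T)))"
proof -
  have fin: "finite (set_pmf A)"
    using A by (simp add: is_noisy_na_alg_def)
  show ?thesis
    unfolding erased_runs_def
    by (subst pmf_expectation_bind[OF fin])
       (auto simp: finite_set_erasure_pmf finite_calls case_prod_unfold integral_measure_pmf[OF fin])
qed

lemma accuracies_valid:
  assumes "(S, \<alpha>) \<in> set_pmf A" "c \<in> calls S"
  shows "0 < (snd \<circ> fst) c \<and> (snd \<circ> fst) c \<le> 1"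
  using assms A by (fastforce simp: calls_def is_noisy_na_alg_def)

lemma expectation_run_estimate:
  "measure_pmf.expectation (erased_runs A) (run_estimate ((!) x)) = pmf (noisy_na_output A x) True"
  unfolding expectation_erased_runs noisy_na_output_def pmf_bind run_estimate_def
  by (intro integral_cong_AE)
     (auto simp: AE_measure_pmf_iff noisy_answers_eq expectation_erasure_estimator[OF finite_calls accuracies_valid]
           simp del: o_apply)

text \<open>For each fixed \<open>(S, \<alpha>)\<close> the second moment is the acceptance
  probability. Averaging over \<open>A\<close> preserves this, so mixing algorithms does not spoil
  the variance bound.\<close>

lemma expectation_run_estimate_square:
  "measure_pmf.expectation (erased_runs A) (\<lambda>b. (run_estimate ((!) x) b)\<^sup>2) = pmf (noisy_na_output A x) True"
  unfolding expectation_erased_runs noisy_na_output_def pmf_bind run_estimate_def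
  by (intro integral_cong_AE)
     (auto simp: AE_measure_pmf_iff noisy_answers_eq expectation_erasure_estimator_square[OF finite_calls accuracies_valid]
           simp del: o_apply)

lemma expectation_card_revealed:
  "measure_pmf.expectation (erased_runs A) (\<lambda>b. real (card (revealed b))) = noisy_na_cost A"
  unfolding expectation_erased_runs noisy_na_cost_def revealed_def
  by (intro integral_cong_AE)
     (auto simp: AE_measure_pmf_iff query_cost_eq_sum_calls expectation_card_erasure[OF finite_calls accuracies_valid]
           simp del: o_apply, simp)

lemma noisy_na_cost_nonneg: "0 \<le> noisy_na_cost A"
  unfolding expectation_card_revealed[symmetric] by simp

text \<open>The exact simulation by 54 erased runs. The height bound uses 324 = 6 * 54, six times
  the number of runs, for Markov's inequality; \<open>t\<close> strictly above the cost keeps this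
  bound positive even at cost 0.\<close>

lemma R_na_le_if_noisy_na_cost_less:
  assumes comp: "computes_to_error (noisy_na_output A) f (1/3)" and t: "noisy_na_cost A < t"
  shows "real (R_na n f) \<le> 324 * t"
proof -
  define d :: erased_run where "d = undefined"
  define P where "P = Pi_pmf {..<54::nat} d (\<lambda>_. erased_runs A)"
  define total where "total \<omega> = (\<Sum>j<54::nat. card (revealed (\<omega> j)))" for \<omega>
  define Q where "Q \<omega> = (\<Union>j<54::nat. (fst \<circ> fst) ` revealed (\<omega> j))" for \<omega>
  \<comment> \<open>Comparing the average of the 54 estimates with 1/2.\<close>
  define \<beta> where "\<beta> \<omega> v \<longleftrightarrow> (\<Sum>j<54::nat. run_estimate v (\<omega> j)) > 27" for \<omega> v
  \<comment> \<open>Height is a worst-case measure while the cost is an expectation, so runs that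
    reveal too much are replaced by a constant answer without queries.\<close>
  define F :: "_ \<Rightarrow> na_alg" where
    "F \<omega> = (if real (total \<omega>) < 324 * t then (Q \<omega>, \<beta> \<omega>) else ({}, \<lambda>_. False))" for \<omega>
  define R where "R = map_pmf F P"
  have t0: "0 < t"
    using t noisy_na_cost_nonneg by simp
  have finP: "finite (set_pmf P)"
    unfolding P_def by (intro finite_set_Pi_pmf finite_set_erased_runs) auto
  have cardQ: "card (Q \<omega>) \<le> total \<omega>" for \<omega>
    unfolding Q_def total_def
    by (rule order.trans[OF card_UN_le]) (auto intro!: sum_mono card_image_le finite_revealed)
  have Qn: "Q \<omega> \<subseteq> {..<n}" if "\<omega> \<in> set_pmf P" for \<omega>
  proof -
    have "\<omega> j \<in> set_pmf (erased_runs A)" if "j < 54" for j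
      using that \<open>\<omega> \<in> set_pmf P\<close> by (auto simp: P_def set_Pi_pmf PiE_dflt_def)
    then show ?thesis
      by (auto simp: Q_def simp del: split_paired_All dest: revealed_index_less)
  qed
  have R: "is_randomized_na_alg n R"
    using Qn by (auto simp: is_randomized_na_alg_def R_def F_def)
  have "na_height R \<le> 324 * t"
  proof -
    have "na_height R \<in> (\<lambda>(S, \<alpha>). card S) ` set_pmf R"
      unfolding na_height_def by (rule Max_in) (auto simp: R_def finP set_pmf_not_empty)
    then obtain \<omega> where "na_height R = card (fst (F \<omega>))"
      by (auto simp: R_def case_prod_unfold)
    moreover have "card (fst (F \<omega>)) \<le> 324 * t"
      using cardQ[of \<omega>] t0 by (auto simp: F_def)
    ultimately show ?thesis by simp
  qed
  moreover have "computes_to_error (randomized_na_output R) f (1/3)"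
    unfolding computes_to_error_def
  proof
    fix x assume x: "x \<in> dom f"
    define g where "g = pmf (noisy_na_output A x) True"
    define b where "b = the (f x)"
    define long where "long = {\<omega>. real (total \<omega>) \<ge> 324 * t}"
    define dev where "dev = {\<omega>. \<bar>(\<Sum>j<54::nat. run_estimate ((!) x) (\<omega> j)) - 54 * g\<bar> \<ge> 9}"
    have correct: "pmf (noisy_na_output A x) b \<ge> 2 / 3"
      using comp x by (auto simp: computes_to_error_def b_def)
    have g: "if b then g \<ge> 2 / 3 else g \<le> 1 / 3"
      using correct by (cases b) (auto simp: g_def pmf_False_conv_True)
    have "measure_pmf.prob P dev \<le> 1 / 6"
      unfolding dev_def P_def
      by (rule prob_sum_iid_deviation)
         (simp_all add: g_def finite_set_erased_runs expectation_run_estimate expectation_run_estimate_square)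
    moreover have "measure_pmf.prob P long \<le> 1 / 6"
    proof -
      have "measure_pmf.expectation P (\<lambda>\<omega>. real (total \<omega>)) = 54 * noisy_na_cost A"
        unfolding P_def total_def of_nat_sum
        by (subst expectation_sum_Pi_pmf) (auto simp: finite_set_erased_runs expectation_card_revealed)
      moreover have "measure_pmf.prob P {\<omega>\<in>space P. real (total \<omega>) \<ge> 324 * t} \<le>
          measure_pmf.expectation P (\<lambda>\<omega>. real (total \<omega>)) / (324 * t)"
        by (rule integral_Markov_inequality_measure[where A = "{}"])
           (use t0 in \<open>auto intro: integrable_measure_pmf_finite[OF finP]\<close>)
      ultimately have "measure_pmf.prob P long \<le> 54 * noisy_na_cost A / (324 * t)"
        by (simp add: long_def)
      also have "\<dots> \<le> 1 / 6"
        using t t0 by (simp add: field_simps)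
      finally show ?thesis .
    qed
    moreover have "na_output (F \<omega>) x = b" if "\<omega> \<notin> long" "\<omega> \<notin> dev" for \<omega>
    proof -
      \<comment> \<open>Every call revealed in run \<open>j\<close> asks for a bit in
        \<open>Q \<omega>\<close>, so the queried bits suffice.\<close>
      have "run_estimate (restrict ((!) x) (Q \<omega>)) (\<omega> j) = run_estimate ((!) x) (\<omega> j)" if "j < 54" for j
        using that by (intro run_estimate_cong) (auto simp: Q_def)
      then have "na_output (F \<omega>) x \<longleftrightarrow> (\<Sum>j<54. run_estimate ((!) x) (\<omega> j)) > 27"
        using that(1) by (simp add: na_output_def F_def long_def \<beta>_def)
      \<comment> \<open>By \<open>g\<close>, the mean \<open>54 * g\<close> is at least 36 or at
        most 18, according to \<open>b\<close>; a deviation strictly below 9 leaves the sum on the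
        correct side of 27.\<close>
      then show ?thesis
        using that(2) g by (auto simp: dev_def abs_if split: if_splits)
    qed
    then have "- (long \<union> dev) \<subseteq> {\<omega>. na_output (F \<omega>) x = b}"
      by auto
    then have "measure_pmf.prob P (- (long \<union> dev)) \<le> measure_pmf.prob P {\<omega>. na_output (F \<omega>) x = b}"
      by (intro measure_pmf.finite_measure_mono) auto
    moreover have "measure_pmf.prob P (- (long \<union> dev)) = 1 - measure_pmf.prob P (long \<union> dev)"
      using measure_pmf.prob_compl[of "long \<union> dev" P] by (simp add: Compl_eq_Diff_UNIV)
    moreover have "measure_pmf.prob P (long \<union> dev) \<le> measure_pmf.prob P long + measure_pmf.prob P dev"
      by (intro measure_Un_le) auto
    moreover have "pmf (randomized_na_output R x) b = measure_pmf.prob P {\<omega>. na_output (F \<omega>) x = b}"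
      by (simp add: randomized_na_output_def R_def pmf.map_comp o_def pmf_map vimage_def)
    ultimately show "1 - 1 / 3 \<le> pmf (randomized_na_output R x) (the (f x))"
      unfolding b_def by linarith
  qed
  then have "R_na n f \<le> na_height R"
    unfolding R_na_def using R by (intro Least_le) auto
  ultimately show ?thesis by linarith
qed

text \<open>Let \<open>t\<close> tend to the cost from above: an excess of \<open>e / 324\<close> in
  \<open>t\<close> is an excess of \<open>e\<close> in the bound.\<close>

lemma R_na_le_noisy_na_cost:
  assumes "computes_to_error (noisy_na_output A) f (1/3)"
  shows "real (R_na n f) \<le> 324 * noisy_na_cost A"
proof (rule field_le_epsilon)
  fix e :: real assume "0 < e"
  then show "real (R_na n f) \<le> 324 * noisy_na_cost A + e"
    using R_na_le_if_noisy_na_cost_less[OF assms, of "noisy_na_cost A + e / 324"] by simp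
qed

end

subsection \<open>From exact to noisy queries\<close>

text \<open>Each index is asked once with accuracy 1, so its only call carries the occurrence number
  0. Restricting the argument of \<open>\<alpha>\<close> to \<open>S\<close> makes the image
  independent of the values of \<open>\<alpha>\<close> outside
  \<open>S \<rightarrow>\<^sub>E UNIV\<close>.\<close>

definition noiseless_alg :: "na_alg \<Rightarrow> noisy_na_alg" where
  "noiseless_alg = (\<lambda>(S, \<alpha>). (image_mset (\<lambda>i. (i, 1)) (mset_set S), \<lambda>y. \<alpha> (restrict (\<lambda>i. y ((i, 1), 0)) S)))"

lemma noisy_oracle_one: "noisy_oracle b 1 = return_pmf b"
proof (rule pmf_eqI)
  show "pmf (noisy_oracle b 1) y = pmf (return_pmf b) y" for y
    by (auto simp: pmf_noisy_oracle sgn_agree_def)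
qed

lemma calls_noiseless:
  assumes "finite S"
  shows "calls (image_mset (\<lambda>i. (i, 1)) (mset_set S)) = (\<lambda>i. ((i, 1), 0)) ` S"
proof -
  have "count (image_mset (\<lambda>i. (i, 1::real)) (mset_set S)) (i, 1) = 1" if "i \<in> S" for i
    using assms that by (subst image_mset_mset_set) (auto simp: inj_on_def)
  then show ?thesis
    using assms by (auto simp: calls_def)
qed

lemma map_noisy_answers_noiseless:
  assumes "finite S"
  shows "map_pmf (snd (noiseless_alg (S, \<alpha>))) (noisy_answers (fst (noiseless_alg (S, \<alpha>))) x) =
    return_pmf (na_output (S, \<alpha>) x)"
proof -
  define C where "C = calls (image_mset (\<lambda>i. (i, 1)) (mset_set S))"
  have fin: "finite C"
    by (simp add: C_def finite_calls)
  have "noisy_answers (image_mset (\<lambda>i. (i, 1)) (mset_set S)) x =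
      Pi_pmf C undefined (\<lambda>c. return_pmf (x ! fst (fst c)))"
    unfolding noisy_answers_eq C_def
    by (intro Pi_pmf_cong) (auto simp: calls_noiseless[OF assms] noisy_oracle_one)
  also have "\<dots> = return_pmf (\<lambda>c. if c \<in> C then x ! fst (fst c) else undefined)"
    using fin by simp
  finally show ?thesis
    using assms
    by (auto simp: noiseless_alg_def na_output_def C_def calls_noiseless intro!: arg_cong[of _ _ \<alpha>])
qed

text \<open>Noisy algorithms must have finite support, whereas a randomized one may mix infinitely
  many \<open>\<alpha>\<close> that differ only outside \<open>S \<rightarrow>\<^sub>E UNIV\<close>.
  Such functions have the same image, and over a finite \<open>U\<close> only finitely many images
  remain.\<close>

lemma finite_range_noiseless_alg:
  assumes "finite U"
  shows "finite (noiseless_alg ` {(S, \<alpha>). S \<subseteq> U})"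
proof -
  define N where "N = (SIGMA S : Pow U. (S \<rightarrow>\<^sub>E (UNIV :: bool set)) \<rightarrow>\<^sub>E (UNIV :: bool set))"
  have "noiseless_alg ` {(S, \<alpha>). S \<subseteq> U} \<subseteq> noiseless_alg ` N"
  proof
    fix D assume "D \<in> noiseless_alg ` {(S, \<alpha>). S \<subseteq> U}"
    then obtain S \<alpha> where "D = noiseless_alg (S, \<alpha>)" "S \<subseteq> U"
      by auto
    moreover have "noiseless_alg (S, \<alpha>) = noiseless_alg (S, restrict \<alpha> (S \<rightarrow>\<^sub>E UNIV))"
      by (auto simp: noiseless_alg_def fun_eq_iff)
    ultimately show "D \<in> noiseless_alg ` N"
      by (intro image_eqI[of _ _ "(S, restrict \<alpha> (S \<rightarrow>\<^sub>E UNIV))"]) (auto simp: N_def)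
  qed
  moreover have "finite N"
    unfolding N_def using assms
    by (intro finite_SigmaI finite_PiE) (auto intro: finite_subset)
  ultimately show ?thesis
    by (meson finite_imageI finite_subset)
qed

lemma noisy_na_alg_of_randomized:
  assumes A: "is_randomized_na_alg n A"
  defines "A' \<equiv> map_pmf noiseless_alg A"
  shows "is_noisy_na_alg n A'" "noisy_na_output A' = randomized_na_output A"
    "noisy_na_cost A' \<le> na_height A"
proof -
  have sub: "S \<subseteq> {..<n}" "finite S" if "(S, \<alpha>) \<in> set_pmf A" for S \<alpha>
    using A that by (auto simp: is_randomized_na_alg_def intro: finite_subset[of _ "{..<n}"])
  have "set_pmf A' \<subseteq> noiseless_alg ` {(S, \<alpha>). S \<subseteq> {..<n}}"
    using sub by (auto simp: A'_def)
  then have fin: "finite (set_pmf A')"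
    using finite_range_noiseless_alg[of "{..<n}"] finite_subset by blast
  then show "is_noisy_na_alg n A'"
    using sub by (fastforce simp: is_noisy_na_alg_def A'_def noiseless_alg_def)
  show "noisy_na_output A' = randomized_na_output A"
  proof
    fix x
    have "noisy_na_output A' x =
        bind_pmf A (\<lambda>D. map_pmf (snd (noiseless_alg D)) (noisy_answers (fst (noiseless_alg D)) x))"
      by (simp add: noisy_na_output_def A'_def bind_map_pmf case_prod_unfold)
    also have "\<dots> = bind_pmf A (\<lambda>D. return_pmf (na_output D x))"
      using sub(2) by (intro bind_pmf_cong refl) (metis map_noisy_answers_noiseless prod.exhaust)
    finally show "noisy_na_output A' x = randomized_na_output A x"
      by (simp add: randomized_na_output_def map_pmf_def)
  qed
  have le: "card S \<le> na_height A" if "(S, \<alpha>) \<in> set_pmf A" for S \<alpha>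
  proof -
    \<comment> \<open>The support of \<open>A\<close> may be infinite, but the set of its query
      counts is finite, so \<open>Max\<close> really is an upper bound.\<close>
    have "(\<lambda>(S, \<alpha>). card S) ` set_pmf A \<subseteq> {..n}"
      using sub(1) card_mono[of "{..<n}"] by fastforce
    then have "finite ((\<lambda>(S, \<alpha>). card S) ` set_pmf A)"
      by (rule finite_subset) simp
    then show ?thesis
      unfolding na_height_def using that by (intro Max_ge) force+
  qed
  have "noisy_na_cost A' \<le> measure_pmf.expectation A' (\<lambda>_. real (na_height A))"
    unfolding noisy_na_cost_def
  proof (rule integral_mono_AE)
    show "AE D in measure_pmf A'. (case D of (S, \<alpha>) \<Rightarrow> query_cost S) \<le> real (na_height A)"
      using le by (auto simp: AE_measure_pmf_iff A'_def noiseless_alg_def query_cost_def image_mset.compositionality o_def)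
  qed (auto intro: integrable_measure_pmf_finite[OF fin])
  then show "noisy_na_cost A' \<le> na_height A"
    by simp
qed

text \<open>Reading all \<open>n\<close> bits computes \<open>f\<close> without error, so
  \<open>LEAST\<close> ranges over a nonempty set of heights and is attained.\<close>

lemma R_na_attained:
  assumes "partial_boolean_function n f"
  obtains A where "is_randomized_na_alg n A" "computes_to_error (randomized_na_output A) f (1/3)"
    "na_height A = R_na n f"
proof -
  define A :: "na_alg pmf" where "A = return_pmf ({..<n}, \<lambda>v. the (f (map v [0..<n])))"
  have "is_randomized_na_alg n A"
    by (simp add: is_randomized_na_alg_def A_def)
  moreover have "computes_to_error (randomized_na_output A) f (1/3)"
    unfolding computes_to_error_def
  proof
    fix x assume "x \<in> dom f"
    then have "length x = n"
      using assms by (auto simp: partial_boolean_function_def)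
    then have "map (restrict ((!) x) {..<n}) [0..<n] = x"
      by (auto intro: nth_equalityI)
    then show "1 - 1 / 3 \<le> pmf (randomized_na_output A x) (the (f x))"
      by (simp add: randomized_na_output_def A_def na_output_def)
  qed
  ultimately have "\<exists>h A. is_randomized_na_alg n A \<and>
      computes_to_error (randomized_na_output A) f (1/3) \<and> na_height A = h"
    by blast
  from LeastI_ex[OF this] show ?thesis
    using that unfolding R_na_def by blast
qed

theorem theorem1p9:
  shows "\<exists>c C :: real. 0 < c \<and> 0 < C \<and>
    (\<forall>(n :: nat) (f :: bool list \<rightharpoonup> bool). partial_boolean_function n f \<longrightarrow>
       c * real (R_na n f) \<le> noisy_R_na n f \<and> noisy_R_na n f \<le> C * real (R_na n f))"
proof (intro exI conjI allI impI)
  fix n :: nat and f :: "bool list \<rightharpoonup> bool"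
  assume "partial_boolean_function n f"
  then obtain A where A: "is_randomized_na_alg n A" "computes_to_error (randomized_na_output A) f (1/3)"
    "na_height A = R_na n f"
    by (rule R_na_attained)
  define costs where "costs = {noisy_na_cost A |A. is_noisy_na_alg n A \<and>
     computes_to_error (noisy_na_output A) f (1/3)}"
  \<comment> \<open>The noiseless version of an optimal exact algorithm shows that
    \<open>costs\<close> is nonempty and also serves as the witness for the upper bound.\<close>
  have mem: "noisy_na_cost (map_pmf noiseless_alg A) \<in> costs"
    unfolding costs_def using A noisy_na_alg_of_randomized[OF A(1)] by auto
  \<comment> \<open>This fixes \<open>c\<close> as the inverse of the simulation factor. Below,
    \<open>C\<close> becomes 1 because an accuracy-1 query costs exactly 1.\<close>
  show "(1 / 324) * real (R_na n f) \<le> noisy_R_na n f"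
    unfolding noisy_R_na_def costs_def[symmetric]
  proof (rule cInf_greatest)
    fix t assume "t \<in> costs"
    then show "(1 / 324) * real (R_na n f) \<le> t"
      using R_na_le_noisy_na_cost by (fastforce simp: costs_def)
  qed (use mem in auto)
  \<comment> \<open>An infimum of reals lies below the members of a set only once the set is known
    to be bounded below.\<close>
  have "bdd_below costs"
    by (rule bdd_belowI[of _ 0]) (auto simp: costs_def noisy_na_cost_nonneg)
  then have "noisy_R_na n f \<le> noisy_na_cost (map_pmf noiseless_alg A)"
    unfolding noisy_R_na_def costs_def[symmetric] by (intro cInf_lower mem)
  then show "noisy_R_na n f \<le> 1 * real (R_na n f)"
    using noisy_na_alg_of_randomized(3)[OF A(1)] A(3) by simp
qed auto

end
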